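(* Let $(G,\tau,\oplus)$ be a (Hausdorff) strongly topological gyrogroup with a symmetric neighborhood base $\mathscr U$ at $0$, and let $H$ be an admissible subgyrogroup of $G$ generated from $\mathscr U$. If $H$ is neutral, then $\pi\chi(G/H)=\chi(G/H)$, i.e. the $\pi$-character and the character of the quotient space $G/H$ coincide.
   Context: A groupoid is a nonempty set with a binary operation; $\mathrm{Aut}(G,\oplus)$ is the set of bijective maps $f:G\to G$ with $f(x\oplus y)=f(x)\oplus f(y)$. A gyrogroup is a groupoid $(G,\oplus)$ such that: (G1) there is a unique $0\in G$ with $0\oplus a=a=a\oplus 0$ for all $a\in G$; (G2) each $x\in G$ has a unique inverse $\ominus x\in G$ with $\ominus x\oplus x=0=x\oplus(\ominus x)$; (G3) for all $x,y\in G$ there is $\mathrm{gyr}[x,y]\in\mathrm{Aut}(G,\oplus)$ with $x\oplus(y\oplus z)=(x\oplus y)\oplus\mathrm{gyr}[x,y](z)$ for all $z\in G$; (G4) $\mathrm{gyr}[x\oplus y,y]=\mathrm{gyr}[x,y]$ for all $x,y\in G$. For $A,B\subset G$, $A\oplus B=\{a\oplus b:a\in A,b\in B\}$ and $\ominus A=\{\ominus a:a\in A\}$; $A$ is symmetric if $\ominus A=A$. A nonempty $H\subset G$ is a subgyrogroup if $\oplus$ restricts to a binary operation on $H$, for all $x,y\in H$ the restriction $\mathrm{gyr}[x,y]|_H:H\to\mathrm{gyr}[x,y](H)$ is a bijective homomorphism, and $(H,\oplus|_{H\times H})$ is a gyrogroup. It is an $L$-subgyrogroup if moreover $\mathrm{gyr}[a,h](H)=H$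 for all $a\in G$, $h\in H$. A topological gyrogroup is a gyrogroup with a topology $\tau$ such that $\oplus:G\times G\to G$ is jointly continuous and $x\mapsto\ominus x$ is continuous. It is a strongly topological gyrogroup with neighborhood base $\mathscr U$ at $0$ if $\mathscr U$ is a neighborhood base at $0$ with $\mathrm{gyr}[x,y](U)=U$ for all $U\in\mathscr U$ and $x,y\in G$; $\mathscr U$ is symmetric if every $U\in\mathscr U$ is symmetric. A subgyrogroup $H$ of $G$ is admissible if there is a sequence $\{U_n:n\in\omega\}$ of open symmetric neighborhoods of $0$ with $U_{n+1}\oplus(U_{n+1}\oplus U_{n+1})\subset U_n$ for all $n\in\omega$ and $H=\bigcap_{n\in\omega}U_n$; it is generated from $\mathscr U$ if such a sequence can be taken with each $U_n\in\mathscr U$. (Such an $H$ is known to be a closed $L$-subgyrogroup.) For an $L$-subgyrogroup $H$, $G/H=\{a\oplus H:a\in G\}$ is a partition of $G$; $\pi:G\to G/H$, $\pi(a)=a\oplus H$, and $G/H$ carries the quotient topology ($O$ is open iff $\pi^{-1}(O)$ is open in $G$). All topological spaces are assumed Hausdorff. An $L$-subgyrogroup $H$ of $G$ is neutral if for every open neighborhood $U$ of $0$ in $G$ there is an open neighborhood $V$ of $0$ with $H\oplus V\subset U\oplus H$. For a space $X$ and $x\in X$: $\chi(x,X)$ is the least cardinality of a local base at $x$; $\pi\chi(x,X)$ is the least cardinality of a local $\pi$-base at $x$, i.e. a family of nonempty open subsets of $X$ such that every open neighborhood of $x$ contains a member of the family. $\chi(X)=\sup_{x\in X}\chi(x,X)$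 and $\pi\chi(X)=\sup_{x\in X}\pi\chi(x,X)$. *)

theory Defs
  imports "HOL-Analysis.Analysis"
begin

section \<open>Gyrogroups\<close>

text \<open>
  The identity, the inverse and the gyrations are parameters; on the carrier each of them is
  determined by the operation. Values outside the carrier are irrelevant, so (G4) is an equality
  of functions on the carrier.
\<close>

locale gyrogroup =
  fixes G :: "'a set"
    and add :: "'a \<Rightarrow> 'a \<Rightarrow> 'a" (infixl "\<oplus>" 65)
    and zero :: 'a
    and neg :: "'a \<Rightarrow> 'a"
    and gyr :: "'a \<Rightarrow> 'a \<Rightarrow> 'a \<Rightarrow> 'a"
  assumes nonempty: "G \<noteq> {}"
    and add_closed: "\<lbrakk>x \<in> G; y \<in> G\<rbrakk> \<Longrightarrow> x \<oplus> y \<in> G"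
    and zero_closed: "zero \<in> G"
    and zero_add: "a \<in> G \<Longrightarrow> zero \<oplus> a = a"
    and add_zero: "a \<in> G \<Longrightarrow> a \<oplus> zero = a"
    and zero_unique: "\<lbrakk>e \<in> G; \<And>a. a \<in> G \<Longrightarrow> e \<oplus> a = a \<and> a \<oplus> e = a\<rbrakk> \<Longrightarrow> e = zero"
    and neg_closed: "x \<in> G \<Longrightarrow> neg x \<in> G"
    and neg_add: "x \<in> G \<Longrightarrow> neg x \<oplus> x = zero"
    and add_neg: "x \<in> G \<Longrightarrow> x \<oplus> neg x = zero"
    and neg_unique: "\<lbrakk>x \<in> G; y \<in> G; y \<oplus> x = zero; x \<oplus> y = zero\<rbrakk> \<Longrightarrow> y = neg x"
    and gyr_bij: "\<lbrakk>x \<in> G; y \<in> G\<rbrakk> \<Longrightarrow> bij_betw (gyr x y) G G"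
    and gyr_hom: "\<lbrakk>x \<in> G; y \<in> G; a \<in> G; b \<in> G\<rbrakk> \<Longrightarrow> gyr x y (a \<oplus> b) = gyr x y a \<oplus> gyr x y b"
    and gyr_assoc: "\<lbrakk>x \<in> G; y \<in> G; z \<in> G\<rbrakk> \<Longrightarrow> x \<oplus> (y \<oplus> z) = (x \<oplus> y) \<oplus> gyr x y z"
    and gyr_loop: "\<lbrakk>x \<in> G; y \<in> G; z \<in> G\<rbrakk> \<Longrightarrow> gyr (x \<oplus> y) y z = gyr x y z"

definition set_add :: "('a \<Rightarrow> 'a \<Rightarrow> 'a) \<Rightarrow> 'a set \<Rightarrow> 'a set \<Rightarrow> 'a set" where
  "set_add add A B = {add a b | a b. a \<in> A \<and> b \<in> B}"

definition symmetric_set :: "('a \<Rightarrow> 'a) \<Rightarrow> 'a set \<Rightarrow> bool" where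
  "symmetric_set neg A \<longleftrightarrow> neg ` A = A"

definition subgyrogroup ::
  "'a set \<Rightarrow> ('a \<Rightarrow> 'a \<Rightarrow> 'a) \<Rightarrow> ('a \<Rightarrow> 'a \<Rightarrow> 'a \<Rightarrow> 'a) \<Rightarrow> 'a set \<Rightarrow> bool" where
  "subgyrogroup G add gyr H \<longleftrightarrow>
     H \<noteq> {} \<and> H \<subseteq> G \<and>
     (\<forall>x\<in>H. \<forall>y\<in>H. add x y \<in> H) \<and>
     (\<forall>x\<in>H. \<forall>y\<in>H. bij_betw (gyr x y) H (gyr x y ` H) \<and>
        (\<forall>a\<in>H. \<forall>b\<in>H. gyr x y (add a b) = add (gyr x y a) (gyr x y b))) \<and>
     (\<exists>zero' neg' gyr'. gyrogroup H add zero' neg' gyr')"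

definition L_subgyrogroup ::
  "'a set \<Rightarrow> ('a \<Rightarrow> 'a \<Rightarrow> 'a) \<Rightarrow> ('a \<Rightarrow> 'a \<Rightarrow> 'a \<Rightarrow> 'a) \<Rightarrow> 'a set \<Rightarrow> bool" where
  "L_subgyrogroup G add gyr H \<longleftrightarrow>
     subgyrogroup G add gyr H \<and> (\<forall>a\<in>G. \<forall>h\<in>H. gyr a h ` H = H)"


section \<open>Topological gyrogroups\<close>

locale topological_gyrogroup = gyrogroup G add zero neg gyr
  for G :: "'a set" and add (infixl "\<oplus>" 65) and zero neg gyr +
  fixes T :: "'a topology"
  assumes topspace_eq: "topspace T = G"
    and continuous_add: "continuous_map (prod_topology T T) T (\<lambda>(x, y). x \<oplus> y)"
    and continuous_neg: "continuous_map T T neg"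

text \<open>The members of a neighborhood base need not be open.\<close>

definition nbhd_base :: "'a topology \<Rightarrow> 'a \<Rightarrow> 'a set set \<Rightarrow> bool" where
  "nbhd_base T x \<U> \<longleftrightarrow>
     (\<forall>U\<in>\<U>. U \<subseteq> topspace T \<and> (\<exists>W. openin T W \<and> x \<in> W \<and> W \<subseteq> U)) \<and>
     (\<forall>W. openin T W \<and> x \<in> W \<longrightarrow> (\<exists>U\<in>\<U>. U \<subseteq> W))"

locale strongly_topological_gyrogroup = topological_gyrogroup G add zero neg gyr T
  for G :: "'a set" and add (infixl "\<oplus>" 65) and zero neg gyr T +
  fixes \<U> :: "'a set set"
  assumes nbhd_base_zero: "nbhd_base T zero \<U>"
    and gyr_invariant: "\<lbrakk>U \<in> \<U>; x \<in> G; y \<in> G\<rbrakk> \<Longrightarrow> gyr x y ` U = U"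

definition admissible_sequence ::
  "('a \<Rightarrow> 'a \<Rightarrow> 'a) \<Rightarrow> 'a \<Rightarrow> ('a \<Rightarrow> 'a) \<Rightarrow> 'a topology \<Rightarrow> (nat \<Rightarrow> 'a set) \<Rightarrow> bool" where
  "admissible_sequence add zero neg T U \<longleftrightarrow>
     (\<forall>n. openin T (U n) \<and> zero \<in> U n \<and> symmetric_set neg (U n) \<and>
          set_add add (U (Suc n)) (set_add add (U (Suc n)) (U (Suc n))) \<subseteq> U n)"

definition admissible_subgyrogroup ::
  "'a set \<Rightarrow> ('a \<Rightarrow> 'a \<Rightarrow> 'a) \<Rightarrow> 'a \<Rightarrow> ('a \<Rightarrow> 'a) \<Rightarrow> ('a \<Rightarrow> 'a \<Rightarrow> 'a \<Rightarrow> 'a) \<Rightarrow> 'a topology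
     \<Rightarrow> 'a set \<Rightarrow> bool" where
  "admissible_subgyrogroup G add zero neg gyr T H \<longleftrightarrow>
     subgyrogroup G add gyr H \<and>
     (\<exists>U. admissible_sequence add zero neg T U \<and> H = (\<Inter>n. U n))"

definition generated_from ::
  "('a \<Rightarrow> 'a \<Rightarrow> 'a) \<Rightarrow> 'a \<Rightarrow> ('a \<Rightarrow> 'a) \<Rightarrow> 'a topology \<Rightarrow> 'a set set \<Rightarrow> 'a set \<Rightarrow> bool" where
  "generated_from add zero neg T \<U> H \<longleftrightarrow>
     (\<exists>U. admissible_sequence add zero neg T U \<and> (\<forall>n. U n \<in> \<U>) \<and> H = (\<Inter>n. U n))"

definition neutral ::
  "'a set \<Rightarrow> ('a \<Rightarrow> 'a \<Rightarrow> 'a) \<Rightarrow> 'a \<Rightarrow> ('a \<Rightarrow> 'a \<Rightarrow> 'a \<Rightarrow> 'a) \<Rightarrow> 'a topology \<Rightarrow> 'a set \<Rightarrow> bool" where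
  "neutral G add zero gyr T H \<longleftrightarrow>
     L_subgyrogroup G add gyr H \<and>
     (\<forall>U. openin T U \<and> zero \<in> U \<longrightarrow>
        (\<exists>V. openin T V \<and> zero \<in> V \<and> set_add add H V \<subseteq> set_add add U H))"

text \<open>
  The L-subgyrogroup clause of \<open>neutral\<close> is automatic for the subgyrogroups considered.
\<close>

lemma (in strongly_topological_gyrogroup) generated_from_imp_L_subgyrogroup:
  assumes "admissible_subgyrogroup G add zero neg gyr T H"
    and "generated_from add zero neg T \<U> H"
  shows "L_subgyrogroup G add gyr H"
proof -
  have sub: "subgyrogroup G add gyr H"
    using assms(1) by (simp add: admissible_subgyrogroup_def)
  then have "H \<subseteq> G"
    by (simp add: subgyrogroup_def)
  obtain U where "admissible_sequence add zero neg T U" and in\<U>: "\<forall>n. U n \<in> \<U>"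
    and H: "H = (\<Inter>n. U n)"
    using assms(2) unfolding generated_from_def by blast
  then have U: "openin T (U n)" "U n \<in> \<U>" for n
    by (simp_all add: admissible_sequence_def)
  have "gyr a h ` H = H" if "a \<in> G" "h \<in> H" for a h
  proof -
    have "h \<in> G" using that \<open>H \<subseteq> G\<close> by auto
    have "inj_on (gyr a h) G"
      using gyr_bij[OF \<open>a \<in> G\<close> \<open>h \<in> G\<close>] by (simp add: bij_betw_def)
    moreover have "\<And>n. U n \<subseteq> G"
      using U(1) openin_subset topspace_eq by blast
    ultimately have "gyr a h ` (\<Inter>n. U n) = (\<Inter>n. gyr a h ` U n)"
      by (intro image_INT) auto
    then show ?thesis
      using gyr_invariant[OF U(2) \<open>a \<in> G\<close> \<open>h \<in> G\<close>] H by simp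
  qed
  with sub show ?thesis
    by (simp add: L_subgyrogroup_def)
qed


section \<open>The quotient space\<close>

definition coset :: "('a \<Rightarrow> 'a \<Rightarrow> 'a) \<Rightarrow> 'a set \<Rightarrow> 'a \<Rightarrow> 'a set" where
  "coset add H a = set_add add {a} H"

definition coset_space ::
  "'a set \<Rightarrow> ('a \<Rightarrow> 'a \<Rightarrow> 'a) \<Rightarrow> 'a topology \<Rightarrow> 'a set \<Rightarrow> 'a set topology" where
  "coset_space G add T H =
     topology (\<lambda>O'. O' \<subseteq> coset add H ` G \<and> openin T {a \<in> G. coset add H a \<in> O'})"

lemma openin_coset_space:
  "openin (coset_space G add T H) O' \<longleftrightarrow>
     O' \<subseteq> coset add H ` G \<and> openin T {a \<in> G. coset add H a \<in> O'}"
proof -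
  let ?P = "\<lambda>O'. O' \<subseteq> coset add H ` G \<and> openin T {a \<in> G. coset add H a \<in> O'}"
  have "istopology ?P"
    unfolding istopology_def
  proof (intro conjI allI impI)
    fix S S' assume "?P S" "?P S'"
    moreover have "{a \<in> G. coset add H a \<in> S \<inter> S'} =
        {a \<in> G. coset add H a \<in> S} \<inter> {a \<in> G. coset add H a \<in> S'}"
      by auto
    ultimately show "S \<inter> S' \<subseteq> coset add H ` G" "openin T {a \<in> G. coset add H a \<in> S \<inter> S'}"
      by auto
  next
    fix K assume "\<forall>S\<in>K. ?P S"
    moreover have "{a \<in> G. coset add H a \<in> \<Union>K} = (\<Union>S\<in>K. {a \<in> G. coset add H a \<in> S})"
      by auto
    ultimately show "\<Union>K \<subseteq> coset add H ` G" "openin T {a \<in> G. coset add H a \<in> \<Union>K}"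
      by auto
  qed
  then show ?thesis
    by (simp add: coset_space_def)
qed

lemma (in topological_gyrogroup) topspace_coset_space:
  "topspace (coset_space G add T H) = coset add H ` G"
proof -
  have "{a \<in> G. coset add H a \<in> coset add H ` G} = topspace T"
    using topspace_eq by auto
  then have "openin (coset_space G add T H) (coset add H ` G)"
    by (simp add: openin_coset_space)
  then show ?thesis
    by (meson openin_coset_space openin_subset openin_topspace subset_antisym)
qed

lemma (in topological_gyrogroup) quotient_map_coset:
  "quotient_map T (coset_space G add T H) (coset add H)"
  unfolding quotient_map_def by (auto simp: topspace_coset_space topspace_eq openin_coset_space)


section \<open>Character and pi-character\<close>

text \<open>
  Cardinals are cardinal well-orders, compared by \<open>ordLeq\<close> and \<open>ordIso\<close>. The least cardinality of
  the members of a nonempty family of sets is attained, and \<open>SOME\<close> picks a member attaining it;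
  the choice matters only up to \<open>ordIso\<close>.
\<close>

definition least_card :: "'b set set \<Rightarrow> 'b rel" where
  "least_card F = card_of (SOME A. A \<in> F \<and> (\<forall>A'\<in>F. (card_of A, card_of A') \<in> ordLeq))"

text \<open>
  Least upper bound of a set of cardinals, taken among the cardinals of sets over the same type;
  an upper bound exists there if the members are cardinals of sets over that type.
\<close>

definition sup_card :: "'b rel set \<Rightarrow> 'b rel" where
  "sup_card R = least_card {A. \<forall>r\<in>R. (r, card_of A) \<in> ordLeq}"

definition local_base :: "'b topology \<Rightarrow> 'b \<Rightarrow> 'b set set \<Rightarrow> bool" where
  "local_base X x B \<longleftrightarrow>
     (\<forall>V\<in>B. openin X V \<and> x \<in> V) \<and>
     (\<forall>U. openin X U \<and> x \<in> U \<longrightarrow> (\<exists>V\<in>B. V \<subseteq> U))"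

definition local_pi_base :: "'b topology \<Rightarrow> 'b \<Rightarrow> 'b set set \<Rightarrow> bool" where
  "local_pi_base X x B \<longleftrightarrow>
     (\<forall>V\<in>B. openin X V \<and> V \<noteq> {}) \<and>
     (\<forall>U. openin X U \<and> x \<in> U \<longrightarrow> (\<exists>V\<in>B. V \<subseteq> U))"

definition character_at :: "'b topology \<Rightarrow> 'b \<Rightarrow> 'b set rel" where
  "character_at X x = least_card {B. local_base X x B}"

definition pi_character_at :: "'b topology \<Rightarrow> 'b \<Rightarrow> 'b set rel" where
  "pi_character_at X x = least_card {B. local_pi_base X x B}"

definition character :: "'b topology \<Rightarrow> 'b set rel" where
  "character X = sup_card (character_at X ` topspace X)"

definition pi_character :: "'b topology \<Rightarrow> 'b set rel" where
  "pi_character X = sup_card (pi_character_at X ` topspace X)"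

lemma least_card:
  assumes "F \<noteq> {}"
  obtains A where "A \<in> F" "least_card F = card_of A"
    "\<And>A'. A' \<in> F \<Longrightarrow> (card_of A, card_of A') \<in> ordLeq"
proof -
  have "\<exists>r\<in>card_of ` F. \<forall>r'\<in>card_of ` F. (r, r') \<in> ordLeq"
    by (rule exists_minim_Card_order) (use assms in \<open>auto simp: card_of_Card_order\<close>)
  then have "\<exists>A. A \<in> F \<and> (\<forall>A'\<in>F. (card_of A, card_of A') \<in> ordLeq)"
    by auto
  from someI_ex[OF this] that show thesis
    unfolding least_card_def by blast
qed

lemma sup_card:
  fixes f :: "'i \<Rightarrow> 'b set" and I :: "'i set" and A :: "'b set"
  defines "R \<equiv> (\<lambda>i. card_of (f i)) ` I"
  shows sup_card_upper: "i \<in> I \<Longrightarrow> (card_of (f i), sup_card R) \<in> ordLeq"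
    and sup_card_least:
      "\<lbrakk>\<And>i. i \<in> I \<Longrightarrow> (card_of (f i), card_of A) \<in> ordLeq\<rbrakk> \<Longrightarrow> (sup_card R, card_of A) \<in> ordLeq"
proof -
  let ?F = "{A :: 'b set. \<forall>r\<in>R. (r, card_of A) \<in> ordLeq}"
  have "UNIV \<in> ?F"
    by (simp add: R_def card_of_mono1)
  then have "?F \<noteq> {}"
    by blast
  from least_card[OF this] obtain S where S: "S \<in> ?F" "sup_card R = card_of S"
    "\<And>A'. A' \<in> ?F \<Longrightarrow> (card_of S, card_of A') \<in> ordLeq"
    unfolding sup_card_def by blast
  show "(card_of (f i), sup_card R) \<in> ordLeq" if "i \<in> I"
    using S(1,2) that by (auto simp: R_def)
  show "(sup_card R, card_of A) \<in> ordLeq"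
    if "\<And>i. i \<in> I \<Longrightarrow> (card_of (f i), card_of A) \<in> ordLeq"
    using S(2) S(3)[of A] that by (auto simp: R_def)
qed

lemma local_base_exists: "local_base X x {U. openin X U \<and> x \<in> U}"
  by (auto simp: local_base_def)

lemma local_pi_base_exists: "local_pi_base X x {U. openin X U \<and> U \<noteq> {}}"
  by (auto simp: local_pi_base_def)

end

theory Submission
  imports Defs
begin

text \<open>
  Gyrations preserve \<open>H\<close>, so left translations permute the cosets of \<open>H\<close> and it suffices to bound
  the character of \<open>G/H\<close> at any point by the \<open>\<pi>\<close>-character at the base point. Given a local
  \<open>\<pi>\<close>-base there, replace each member \<open>P\<close>, with preimage \<open>W\<close> in \<open>G\<close>, by the image of
  \<open>\<ominus>W \<oplus> W\<close>. If \<open>W \<subseteq> V \<oplus> H\<close> with \<open>V\<close> symmetric and invariant under gyrations, then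
  \<open>\<ominus>W \<oplus> W \<subseteq> (H \<oplus> (V \<oplus> V)) \<oplus> H\<close>, and by neutrality the right-hand side lies in a prescribed
  \<open>H\<close>-saturated neighborhood of \<open>0\<close> once \<open>V\<close> is small.
\<close>

section \<open>Character and \<open>\<pi>\<close>-character\<close>

lemma least_card_le:
  assumes "A \<in> F"
  shows "(least_card F, card_of A) \<in> ordLeq"
proof -
  have "F \<noteq> {}"
    using assms by blast
  then show ?thesis
    by (rule least_card) (use assms in auto)
qed

lemma least_card_is_card_of: "\<exists>S. least_card F = card_of S"
  unfolding least_card_def by blast

text \<open>\<open>sup_card\<close> takes upper bounds among cardinals of sets over one type, so the
  witnesses \<open>f'\<close> and \<open>g'\<close> present the members in that form. Once each
  \<open>f i\<close> lies below some \<open>g j\<close>, the second supremum bounds the first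
  family.\<close>

lemma sup_card_mono:
  fixes f :: "'i \<Rightarrow> 'b rel" and g :: "'j \<Rightarrow> 'b rel"
  assumes f: "\<And>i. i \<in> I \<Longrightarrow> f i = card_of (f' i)"
    and g: "\<And>j. j \<in> J \<Longrightarrow> g j = card_of (g' j)"
    and le: "\<And>i. i \<in> I \<Longrightarrow> \<exists>j\<in>J. (f i, g j) \<in> ordLeq"
  shows "(sup_card (f ` I), sup_card (g ` J)) \<in> ordLeq"
proof -
  have fI: "f ` I = (\<lambda>i. card_of (f' i)) ` I" and gJ: "g ` J = (\<lambda>j. card_of (g' j)) ` J"
    using f g by (auto intro!: image_cong)
  obtain S where S: "sup_card (g ` J) = card_of S"
    unfolding sup_card_def using least_card_is_card_of by blast
  have *: "(card_of (f' i), card_of S) \<in> ordLeq" if i: "i \<in> I" for i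
  proof -
    obtain j where j: "j \<in> J" "(f i, g j) \<in> ordLeq"
      using le[OF i] by blast
    have "(g j, sup_card (g ` J)) \<in> ordLeq"
      using sup_card_upper[OF j(1), of g'] g[OF j(1)] gJ by simp
    with j(2) show ?thesis
      using f[OF i] S ordLeq_transitive by metis
  qed
  show ?thesis
    unfolding S unfolding fI by (rule sup_card_least) (rule *)
qed

lemma character_at_is_card_of: "\<exists>S. character_at X x = card_of S"
  unfolding character_at_def by (rule least_card_is_card_of)

lemma pi_character_at_is_card_of: "\<exists>S. pi_character_at X x = card_of S"
  unfolding pi_character_at_def by (rule least_card_is_card_of)

lemma local_base_imp_local_pi_base: "local_base X x B \<Longrightarrow> local_pi_base X x B"
  unfolding local_base_def local_pi_base_def by blast

lemma pi_character_at_le_character_at: "(pi_character_at X x, character_at X x) \<in> ordLeq"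
proof -
  have "{B. local_base X x B} \<noteq> {}"
    using local_base_exists[of X x] by blast
  then obtain B where "local_base X x B" "character_at X x = card_of B"
    unfolding character_at_def by (rule least_card) auto
  then show ?thesis
    by (simp add: pi_character_at_def least_card_le local_base_imp_local_pi_base)
qed

text \<open>An image of a family is at most as large as the family, so it suffices to turn a
  smallest local \<pi>-base at \<open>y\<close> into a local base at \<open>x\<close> member by
  member; the points may differ.\<close>

lemma character_at_le_pi_character_at:
  assumes "\<And>B. local_pi_base X y B \<Longrightarrow> \<exists>f. local_base X x (f ` B)"
  shows "(character_at X x, pi_character_at X y) \<in> ordLeq"
proof -
  have "{B. local_pi_base X y B} \<noteq> {}"
    using local_pi_base_exists[of X y] by blast
  then obtain B where B: "local_pi_base X y B" "pi_character_at X y = card_of B"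
    unfolding pi_character_at_def by (rule least_card) auto
  obtain f where "local_base X x (f ` B)"
    using assms B(1) by blast
  then have "(character_at X x, card_of (f ` B)) \<in> ordLeq"
    by (simp add: character_at_def least_card_le)
  then show ?thesis
    using B(2) card_of_image ordLeq_transitive by metis
qed

lemma pi_character_ordIso_character:
  assumes "y \<in> topspace X"
    and "\<And>x B. \<lbrakk>x \<in> topspace X; local_pi_base X y B\<rbrakk> \<Longrightarrow> \<exists>f. local_base X x (f ` B)"
  shows "(pi_character X, character X) \<in> ordIso"
proof -
  obtain c p where c: "\<And>x. character_at X x = card_of (c x)"
    and p: "\<And>x. pi_character_at X x = card_of (p x)"
    using character_at_is_card_of pi_character_at_is_card_of by metis
  have "(pi_character X, character X) \<in> ordLeq"
    unfolding pi_character_def character_def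
    by (rule sup_card_mono[OF p c]) (auto intro: pi_character_at_le_character_at)
  moreover have "(character X, pi_character X) \<in> ordLeq"
    unfolding pi_character_def character_def
    by (rule sup_card_mono[OF c p])
      (use assms in \<open>auto intro!: bexI[of _ y] character_at_le_pi_character_at\<close>)
  ultimately show ?thesis
    by (simp add: ordIso_iff_ordLeq)
qed

section \<open>Gyrogroup identities\<close>

context gyrogroup
begin

lemma gyr_closed: "\<lbrakk>x \<in> G; y \<in> G; z \<in> G\<rbrakk> \<Longrightarrow> gyr x y z \<in> G"
  using gyr_bij bij_betwE by blast

lemma left_cancel:
  assumes "a \<in> G" "b \<in> G" "c \<in> G" "a \<oplus> b = a \<oplus> c"
  shows "b = c"
proof -
  have "gyr (neg a) a b = gyr (neg a) a c"
    using gyr_assoc[of "neg a" a b] gyr_assoc[of "neg a" a c] assms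
    by (simp add: neg_closed neg_add zero_add gyr_closed)
  moreover have "inj_on (gyr (neg a) a) G"
    using gyr_bij assms(1) neg_closed bij_betw_imp_inj_on by blast
  ultimately show ?thesis
    using assms inj_onD by metis
qed

text \<open>By (G4), \<open>gyr (neg a) a\<close> agrees with \<open>gyr zero a\<close>, which is
  the identity on \<open>G\<close> by left cancellation.\<close>

lemma neg_add_cancel:
  assumes "a \<in> G" "b \<in> G"
  shows "neg a \<oplus> (a \<oplus> b) = b"
proof -
  have "a \<oplus> gyr zero a b = a \<oplus> b"
    using gyr_assoc[of zero a b] assms by (simp add: zero_closed zero_add add_closed)
  then have "gyr zero a b = b"
    using assms left_cancel gyr_closed zero_closed by metis
  moreover have "gyr (neg a) a b = gyr zero a b"
    using gyr_loop[of "neg a" a b] assms by (simp add: neg_closed neg_add)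
  ultimately show ?thesis
    using gyr_assoc[of "neg a" a b] assms by (simp add: neg_closed neg_add zero_add)
qed

lemma neg_neg: "a \<in> G \<Longrightarrow> neg (neg a) = a"
  using neg_unique[of "neg a" a] by (simp add: neg_closed neg_add add_neg)

lemma add_neg_cancel: "\<lbrakk>a \<in> G; b \<in> G\<rbrakk> \<Longrightarrow> a \<oplus> (neg a \<oplus> b) = b"
  using neg_add_cancel[of "neg a" b] by (simp add: neg_closed neg_neg)

text \<open>Both sides are right inverses of \<open>a \<oplus> b\<close>, so left cancellation
  identifies them.\<close>

lemma neg_add_distrib:
  assumes "a \<in> G" "b \<in> G"
  shows "neg (a \<oplus> b) = gyr a b (neg b \<oplus> neg a)"
proof -
  have "(a \<oplus> b) \<oplus> gyr a b (neg b \<oplus> neg a) = a \<oplus> (b \<oplus> (neg b \<oplus> neg a))"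
    using gyr_assoc[of a b "neg b \<oplus> neg a"] assms by (simp add: add_closed neg_closed)
  also have "\<dots> = (a \<oplus> b) \<oplus> neg (a \<oplus> b)"
    using assms by (simp add: add_neg_cancel neg_closed add_neg add_closed)
  finally show ?thesis
    using left_cancel[of "a \<oplus> b"] assms add_closed neg_closed gyr_closed by metis
qed

text \<open>Moving brackets to the right replaces the last summand by its preimage under
  \<open>gyr x y\<close>; invariance of \<open>A\<close> provides such a preimage inside
  \<open>A\<close>.\<close>

lemma add_assoc_invariant:
  assumes "x \<in> G" "y \<in> G" "z \<in> A" "A \<subseteq> G" "gyr x y ` A = A"
  obtains z' where "z' \<in> A" "(x \<oplus> y) \<oplus> z = x \<oplus> (y \<oplus> z')"
proof -
  have "z \<in> gyr x y ` A"
    using assms(3,5) by simp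
  then obtain z' where z': "z' \<in> A" "z = gyr x y z'"
    by blast
  then have "(x \<oplus> y) \<oplus> z = x \<oplus> (y \<oplus> z')"
    using gyr_assoc[of x y z'] assms(1,2,4) by auto
  with z'(1) show thesis
    by (rule that)
qed

end

section \<open>Cosets of a gyration-invariant subgyrogroup\<close>

text \<open>Invariance under all gyrations of \<open>G\<close>, rather than only under
  \<open>gyr a h\<close> with \<open>h \<in> H\<close>, is what lets left translations act on the
  cosets.\<close>

locale topological_gyrogroup_invariant_sub = topological_gyrogroup +
  fixes H
  assumes H_subset: "H \<subseteq> G"
    and zero_H: "zero \<in> H"
    and add_H: "\<lbrakk>h \<in> H; k \<in> H\<rbrakk> \<Longrightarrow> h \<oplus> k \<in> H"
    and neg_H: "h \<in> H \<Longrightarrow> neg h \<in> H"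
    and gyr_H: "\<lbrakk>x \<in> G; y \<in> G\<rbrakk> \<Longrightarrow> gyr x y ` H = H"
begin

lemma in_G_if_in_H [simp]: "h \<in> H \<Longrightarrow> h \<in> G"
  using H_subset by blast

lemma gyr_mem_H: "\<lbrakk>x \<in> G; y \<in> G; h \<in> H\<rbrakk> \<Longrightarrow> gyr x y h \<in> H"
  using gyr_H[of x y] imageI[of h H "gyr x y"] by simp

abbreviation proj :: "'a \<Rightarrow> 'a set" where
  "proj \<equiv> coset (\<oplus>) H"

abbreviation quotient :: "'a set topology" where
  "quotient \<equiv> coset_space G (\<oplus>) T H"

lemma coset_eq: "proj a = (\<lambda>h. a \<oplus> h) ` H"
  by (auto simp: coset_def set_add_def)

lemma coset_add_subset:
  assumes "a \<in> G" "h \<in> H"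
  shows "proj (a \<oplus> h) \<subseteq> proj a"
proof
  fix x assume "x \<in> proj (a \<oplus> h)"
  then obtain k where "k \<in> H" "x = (a \<oplus> h) \<oplus> k"
    by (auto simp: coset_eq)
  moreover obtain k' where "k' \<in> H" "(a \<oplus> h) \<oplus> k = a \<oplus> (h \<oplus> k')"
    by (rule add_assoc_invariant[of a h k H])
      (use assms \<open>k \<in> H\<close> H_subset gyr_H in auto)
  ultimately show "x \<in> proj a"
    using assms add_H by (auto simp: coset_eq)
qed

text \<open>The element \<open>gyr a h (neg h)\<close> undoes right translation by \<open>h\<close>.
  This reduces the second inclusion in \<open>coset_add\<close> to the first.\<close>

lemma add_H_reverse:
  assumes "a \<in> G" "h \<in> H"
  obtains k where "k \<in> H" "(a \<oplus> h) \<oplus> k = a"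
proof
  show "gyr a h (neg h) \<in> H"
    using assms by (simp add: gyr_mem_H neg_H)
  show "(a \<oplus> h) \<oplus> gyr a h (neg h) = a"
    using gyr_assoc[of a h "neg h"] assms by (simp add: neg_closed add_neg add_zero)
qed

lemma coset_add:
  assumes "a \<in> G" "h \<in> H"
  shows "proj (a \<oplus> h) = proj a"
proof
  obtain k where "k \<in> H" "(a \<oplus> h) \<oplus> k = a"
    using add_H_reverse assms by blast
  then show "proj a \<subseteq> proj (a \<oplus> h)"
    using coset_add_subset[of "a \<oplus> h" k] assms add_closed by simp
qed (rule coset_add_subset[OF assms])

lemma mem_coset_self: "a \<in> G \<Longrightarrow> a \<in> proj a"
  unfolding coset_eq by (rule image_eqI[OF _ zero_H]) (simp add: add_zero)

lemma coset_eqD: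
  assumes "a \<in> G" "proj a = proj b"
  obtains h where "h \<in> H" "a = b \<oplus> h"
proof -
  have "a \<in> proj b"
    using mem_coset_self[OF assms(1)] assms(2) by simp
  then show thesis
    using that unfolding coset_eq by blast
qed

text \<open>Reassociating \<open>g \<oplus> (b \<oplus> h)\<close> applies \<open>gyr g b\<close> to
  \<open>h\<close>, which stays in \<open>H\<close>.\<close>

lemma coset_add_left:
  assumes "g \<in> G" "a \<in> G" "b \<in> G" "proj a = proj b"
  shows "proj (g \<oplus> a) = proj (g \<oplus> b)"
proof -
  obtain h where h: "h \<in> H" "a = b \<oplus> h"
    using coset_eqD assms by blast
  then have "g \<oplus> a = (g \<oplus> b) \<oplus> gyr g b h"
    using gyr_assoc assms by simp
  moreover have "gyr g b h \<in> H"
    using assms h by (simp add: gyr_mem_H)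
  ultimately show ?thesis
    using coset_add assms add_closed by simp
qed

section \<open>Translations and the openness of the projection\<close>

lemma continuous_add_left:
  assumes "g \<in> G"
  shows "continuous_map T T (\<lambda>x. g \<oplus> x)"
proof -
  have "continuous_map T (prod_topology T T) (\<lambda>x. (g, x))"
    using assms topspace_eq by (simp add: continuous_map_pairwise o_def)
  from continuous_map_compose[OF this continuous_add] show ?thesis
    by (simp add: o_def)
qed

lemma continuous_add_right:
  assumes "g \<in> G"
  shows "continuous_map T T (\<lambda>x. x \<oplus> g)"
proof -
  have "continuous_map T (prod_topology T T) (\<lambda>x. (x, g))"
    using assms topspace_eq by (simp add: continuous_map_pairwise o_def)
  from continuous_map_compose[OF this continuous_add] show ?thesis
    by (simp add: o_def)
qed

lemma openin_subset_G: "openin T W \<Longrightarrow> W \<subseteq> G"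
  using openin_subset topspace_eq by blast

lemma openin_add_left:
  assumes "g \<in> G" "openin T W"
  shows "openin T ((\<lambda>x. g \<oplus> x) ` W)"
proof -
  \<comment> \<open>Left translation by \<open>neg g\<close> inverts left translation by
    \<open>g\<close>, so the image is a preimage under a continuous map.\<close>
  have "(\<lambda>x. g \<oplus> x) ` W = {x \<in> topspace T. neg g \<oplus> x \<in> W}"
  proof (intro set_eqI iffI)
    fix x assume "x \<in> {x \<in> topspace T. neg g \<oplus> x \<in> W}"
    then have "neg g \<oplus> x \<in> W" "g \<oplus> (neg g \<oplus> x) = x"
      using assms add_neg_cancel topspace_eq by auto
    then show "x \<in> (\<lambda>x. g \<oplus> x) ` W"
      by (metis imageI)
  next
    fix x assume "x \<in> (\<lambda>x. g \<oplus> x) ` W"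
    then show "x \<in> {x \<in> topspace T. neg g \<oplus> x \<in> W}"
      using assms openin_subset_G[OF assms(2)]
      by (auto simp: neg_add_cancel add_closed topspace_eq subset_eq)
  qed
  then show ?thesis
    using openin_continuous_map_preimage[OF continuous_add_left assms(2)] assms(1) neg_closed
    by simp
qed

lemma openin_image_coset:
  assumes "openin T W"
  shows "openin quotient (proj ` W)"
proof -
  note W = openin_subset_G[OF assms]
  text \<open>As a union of preimages, \<open>W \<oplus> H\<close> is open without appeal to the openness of right
    translations.\<close>
  have "{a \<in> G. proj a \<in> proj ` W} = (\<Union>k\<in>H. {a \<in> topspace T. a \<oplus> k \<in> W})"
  proof (intro set_eqI iffI)
    fix a assume "a \<in> {a \<in> G. proj a \<in> proj ` W}"
    then obtain w where w: "a \<in> G" "w \<in> W" "proj w = proj a"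
      by auto
    then obtain h where "h \<in> H" "w = a \<oplus> h"
      using coset_eqD W by blast
    with w show "a \<in> (\<Union>k\<in>H. {a \<in> topspace T. a \<oplus> k \<in> W})"
      using topspace_eq by auto
  next
    fix a assume "a \<in> (\<Union>k\<in>H. {a \<in> topspace T. a \<oplus> k \<in> W})"
    then obtain k where "k \<in> H" "a \<in> G" "a \<oplus> k \<in> W"
      using topspace_eq by auto
    then show "a \<in> {a \<in> G. proj a \<in> proj ` W}"
      using coset_add[of a k] by (metis (mono_tags, lifting) imageI mem_Collect_eq)
  qed
  also have "openin T \<dots>"
    using openin_continuous_map_preimage[OF continuous_add_right assms] by (intro openin_Union) auto
  finally show ?thesis
    using W by (auto simp: openin_coset_space)
qed

section \<open>Difference sets\<close>

definition differences :: "'a set \<Rightarrow> 'a set" where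
  "differences W = set_add (\<oplus>) (neg ` W) W"

lemma openin_differences:
  assumes "openin T W"
  shows "openin T (differences W)"
proof -
  have "differences W = (\<Union>w\<in>W. (\<lambda>x. neg w \<oplus> x) ` W)"
    by (auto simp: differences_def set_add_def)
  then show ?thesis
    using openin_subset_G[OF assms] by (auto intro!: openin_add_left neg_closed assms)
qed

lemma zero_in_differences:
  assumes "W \<subseteq> G" "W \<noteq> {}"
  shows "zero \<in> differences W"
proof -
  obtain w where "w \<in> W"
    using assms(2) by blast
  then have "neg w \<oplus> w \<in> differences W" "neg w \<oplus> w = zero"
    using assms(1) neg_add unfolding differences_def set_add_def by blast+
  then show ?thesis
    by simp
qed

lemma differences_subset:
  assumes V: "V \<subseteq> G" "neg ` V = V" "\<And>x y. \<lbrakk>x \<in> G; y \<in> G\<rbrakk> \<Longrightarrow> gyr x y ` V = V"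
    and W: "W \<subseteq> set_add (\<oplus>) V H"
  shows "differences W \<subseteq> set_add (\<oplus>) (set_add (\<oplus>) H (set_add (\<oplus>) V V)) H"
proof
  fix x assume "x \<in> differences W"
  then obtain v h v' h' where vh: "v \<in> V" "h \<in> H" "v' \<in> V" "h' \<in> H"
      and x: "x = neg (v \<oplus> h) \<oplus> (v' \<oplus> h')"
    using W unfolding differences_def set_add_def by blast
  have G: "v \<in> G" "h \<in> G" "v' \<in> G" "h' \<in> G"
    using vh V(1) by auto
  \<comment> \<open>Inverting \<open>v \<oplus> h\<close> reverses the order and applies
    \<open>gyr v h\<close> to both summands; \<open>H\<close> and \<open>V\<close> are closed under
    these operations, so the \<open>H\<close>-part now stands on the left.\<close>
  define h1 where "h1 = gyr v h (neg h)"
  define v1 where "v1 = gyr v h (neg v)"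
  have h1: "h1 \<in> H"
    unfolding h1_def using G vh by (simp add: gyr_mem_H neg_H)
  have v1: "v1 \<in> V"
    using V(2) V(3)[of v h] G vh(1) v1_def by blast
  have inG: "h1 \<in> G" "v1 \<in> G"
    using h1 v1 V(1) by auto
  have "neg (v \<oplus> h) = h1 \<oplus> v1"
    using G by (simp add: neg_add_distrib gyr_hom neg_closed h1_def v1_def)
  then have "x = ((h1 \<oplus> v1) \<oplus> v') \<oplus> gyr (h1 \<oplus> v1) v' h'"
    using x gyr_assoc G inG add_closed by simp
  moreover obtain v2 where "v2 \<in> V" "(h1 \<oplus> v1) \<oplus> v' = h1 \<oplus> (v1 \<oplus> v2)"
    using add_assoc_invariant[OF inG vh(3) V(1) V(3)[OF inG]] .
  moreover have "gyr (h1 \<oplus> v1) v' h' \<in> H"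
    using inG G vh by (simp add: gyr_mem_H add_closed)
  ultimately show "x \<in> set_add (\<oplus>) (set_add (\<oplus>) H (set_add (\<oplus>) V V)) H"
    using h1 v1 unfolding set_add_def by blast
qed

lemma nbhd_add_subset:
  assumes "openin T V" "zero \<in> V"
  obtains N where "openin T N" "zero \<in> N" "set_add (\<oplus>) N N \<subseteq> V"
proof -
  let ?S = "{p \<in> topspace (prod_topology T T). (\<lambda>(x, y). x \<oplus> y) p \<in> V}"
  have S: "openin (prod_topology T T) ?S"
    using openin_continuous_map_preimage[OF continuous_add assms(1)] .
  have zero_S: "(zero, zero) \<in> ?S"
    using assms topspace_eq by (simp add: zero_closed zero_add)
  obtain A B where "openin T A" "openin T B" "zero \<in> A" "zero \<in> B" "A \<times> B \<subseteq> ?S"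
    using S[unfolded openin_prod_topology_alt, rule_format, OF zero_S] by blast
  then show thesis
    by (intro that[of "A \<inter> B"]) (auto simp: set_add_def)
qed

text \<open>A member of the \<pi>-base may miss the base point, but the difference set of its
  preimage contains \<open>zero\<close>; left translation by \<open>g\<close> then carries it to
  \<open>proj g\<close>.\<close>

lemma local_base_of_local_pi_base:
  assumes base: "nbhd_base T zero \<U>"
    and sym: "\<And>U. U \<in> \<U> \<Longrightarrow> neg ` U = U"
    and inv: "\<And>U x y. \<lbrakk>U \<in> \<U>; x \<in> G; y \<in> G\<rbrakk> \<Longrightarrow> gyr x y ` U = U"
    and neutral: "neutral G (\<oplus>) zero gyr T H"
    and B: "local_pi_base quotient (proj zero) B"
    and g: "g \<in> G"
  shows "local_base quotient (proj g)
    ((\<lambda>P. proj ` (\<lambda>x. g \<oplus> x) ` differences {a \<in> G. proj a \<in> P}) ` B)"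
  unfolding local_base_def
proof (intro conjI ballI allI impI)
  fix Q assume "Q \<in> (\<lambda>P. proj ` (\<lambda>x. g \<oplus> x) ` differences {a \<in> G. proj a \<in> P}) ` B"
  then obtain P where P: "P \<in> B"
      and Q: "Q = proj ` (\<lambda>x. g \<oplus> x) ` differences {a \<in> G. proj a \<in> P}"
    by blast
  let ?W = "{a \<in> G. proj a \<in> P}"
  have P_open: "openin quotient P" "P \<noteq> {}"
    using B P by (auto simp: local_pi_base_def)
  then have W: "openin T ?W" "?W \<noteq> {}"
    by (auto simp: openin_coset_space)
  show "openin quotient Q"
    unfolding Q by (intro openin_image_coset openin_add_left openin_differences W g)
  have "g \<oplus> zero = g" "zero \<in> differences ?W"
    using W(2) g by (auto intro!: zero_in_differences simp: add_zero)
  then show "proj g \<in> Q"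
    unfolding Q by (metis imageI)
next
  fix Q assume "openin quotient Q \<and> proj g \<in> Q"
  then have Q: "openin T {a \<in> G. proj a \<in> Q}" "proj g \<in> Q"
    by (auto simp: openin_coset_space)
  \<comment> \<open>Pulling \<open>Q\<close> back along the translation by \<open>g\<close> moves
    the problem to \<open>zero\<close>. This \<open>U\<close> is a union of cosets, so adding
    \<open>H\<close> on the right, even twice, does not leave it.\<close>
  define U where "U = {x \<in> topspace T. g \<oplus> x \<in> {a \<in> G. proj a \<in> Q}}"
  have U: "openin T U" "zero \<in> U"
    using openin_continuous_map_preimage[OF continuous_add_left[OF g] Q(1)] Q(2) g topspace_eq
    by (simp_all add: U_def add_zero zero_closed)
  have U_coset: "proj (g \<oplus> x) \<in> Q" if x: "x \<in> set_add (\<oplus>) (set_add (\<oplus>) U H) H" for x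
  proof -
    obtain u h k where "u \<in> U" "h \<in> H" "k \<in> H" "x = (u \<oplus> h) \<oplus> k"
      using x unfolding set_add_def by blast
    moreover from this have "u \<in> G" "proj (g \<oplus> u) \<in> Q"
      using topspace_eq by (auto simp: U_def)
    moreover from calculation have "proj x = proj u"
      by (simp add: coset_add add_closed)
    ultimately show ?thesis
      using coset_add_left[of g x u] g add_closed by simp
  qed
  \<comment> \<open>Neutrality moves the left summand \<open>H\<close> to the right, where
    \<open>U\<close> absorbs it. \<open>N\<close> then makes room for a sum of two elements, and
    \<open>M\<close> adds symmetry and invariance.\<close>
  obtain V where V: "openin T V" "zero \<in> V" "set_add (\<oplus>) H V \<subseteq> set_add (\<oplus>) U H"
    using neutral U unfolding neutral_def by blast
  obtain N where N: "openin T N" "zero \<in> N" "set_add (\<oplus>) N N \<subseteq> V"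
    using nbhd_add_subset V by blast
  obtain M where M: "M \<in> \<U>" "M \<subseteq> N"
    using base N unfolding nbhd_base_def by blast
  \<comment> \<open>Members of \<open>\<U>\<close> may fail to be open, so the \<pi>-base is applied
    to the projection of an open \<open>I\<close> inside \<open>M\<close>.\<close>
  obtain I where I: "openin T I" "zero \<in> I" "I \<subseteq> M"
    using bspec[OF conjunct1[OF base[unfolded nbhd_base_def]] M(1)] by blast
  have "openin quotient (proj ` I)" "proj zero \<in> proj ` I"
    using openin_image_coset I by auto
  then have "\<exists>P\<in>B. P \<subseteq> proj ` I"
    using B unfolding local_pi_base_def by simp
  then obtain P where P: "P \<in> B" "P \<subseteq> proj ` I"
    by blast
  let ?W = "{a \<in> G. proj a \<in> P}"
  have M_G: "M \<subseteq> G"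
    using M(2) openin_subset_G[OF N(1)] by blast
  have "?W \<subseteq> set_add (\<oplus>) M H"
  proof
    fix a assume "a \<in> ?W"
    then obtain i where i: "i \<in> I" "a \<in> G" "proj a = proj i"
      using P(2) by auto
    obtain h where "h \<in> H" "a = i \<oplus> h"
      by (rule coset_eqD[OF i(2,3)])
    then show "a \<in> set_add (\<oplus>) M H"
      using I(3) i(1) unfolding set_add_def by blast
  qed
  then have "differences ?W \<subseteq> set_add (\<oplus>) (set_add (\<oplus>) H (set_add (\<oplus>) M M)) H"
    by (intro differences_subset M_G sym inv M(1))
  also have "\<dots> \<subseteq> set_add (\<oplus>) (set_add (\<oplus>) U H) H"
  proof -
    have "set_add (\<oplus>) M M \<subseteq> V"
      using N(3) M(2) unfolding set_add_def by blast
    then have "set_add (\<oplus>) H (set_add (\<oplus>) M M) \<subseteq> set_add (\<oplus>) U H"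
      using V(3) unfolding set_add_def by blast
    then show ?thesis
      unfolding set_add_def by blast
  qed
  finally have "proj ` (\<lambda>x. g \<oplus> x) ` differences ?W \<subseteq> Q"
    using U_coset by blast
  then show "\<exists>V\<in>(\<lambda>P. proj ` (\<lambda>x. g \<oplus> x) ` differences {a \<in> G. proj a \<in> P}) ` B. V \<subseteq> Q"
    using P(1) by blast
qed

end

text \<open>Every gyration fixes each \<open>U n\<close> and is injective on \<open>G\<close>, so it
  commutes with the intersection and fixes \<open>H\<close>. Symmetry of the \<open>U n\<close>
  gives closure under \<open>neg\<close>, taken in \<open>G\<close>.\<close>

lemma (in strongly_topological_gyrogroup) generated_from_imp_invariant_sub:
  assumes "subgyrogroup G (\<oplus>) gyr H" "generated_from (\<oplus>) zero neg T \<U> H"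
  shows "topological_gyrogroup_invariant_sub G (\<oplus>) zero neg gyr T H"
proof -
  obtain U where "admissible_sequence (\<oplus>) zero neg T U" and U\<U>: "\<And>n. U n \<in> \<U>"
    and H: "H = (\<Inter>n. U n)"
    using assms(2) unfolding generated_from_def by blast
  then have U: "openin T (U n)" "zero \<in> U n" "neg ` U n = U n" for n
    by (simp_all add: admissible_sequence_def symmetric_set_def)
  have UG: "U n \<subseteq> G" for n
    using U(1) openin_subset topspace_eq by blast
  show ?thesis
  proof
    show "H \<subseteq> G"
      using UG H by blast
    show "zero \<in> H"
      using U(2) H by blast
    show "h \<oplus> k \<in> H" if "h \<in> H" "k \<in> H" for h k
      using assms(1) that by (auto simp: subgyrogroup_def)
    show "neg h \<in> H" if "h \<in> H" for h
      using U(3) that unfolding H by blast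
    show "gyr x y ` H = H" if "x \<in> G" "y \<in> G" for x y
    proof -
      have "inj_on (gyr x y) G"
        using gyr_bij that bij_betw_imp_inj_on by blast
      then have "gyr x y ` H = (\<Inter>n. gyr x y ` U n)"
        unfolding H using UG by (intro image_INT) auto
      then show ?thesis
        using gyr_invariant[OF U\<U> that] H by simp
    qed
  qed
qed

theorem theorem4p1:
  fixes G :: "'a set"
    and add :: "'a \<Rightarrow> 'a \<Rightarrow> 'a"
    and zero :: 'a
    and neg :: "'a \<Rightarrow> 'a"
    and gyr :: "'a \<Rightarrow> 'a \<Rightarrow> 'a \<Rightarrow> 'a"
    and T :: "'a topology"
    and \<U> :: "'a set set"
    and H :: "'a set"
  assumes "strongly_topological_gyrogroup G add zero neg gyr T \<U>"
    and "Hausdorff_space T"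
    and "\<forall>U\<in>\<U>. symmetric_set neg U"
    and "admissible_subgyrogroup G add zero neg gyr T H"
    and "generated_from add zero neg T \<U> H"
    and "neutral G add zero gyr T H"
  shows "(pi_character (coset_space G add T H), character (coset_space G add T H)) \<in> ordIso"
proof -
  interpret strongly_topological_gyrogroup G add zero neg gyr T \<U>
    by (rule assms(1))
  interpret topological_gyrogroup_invariant_sub G add zero neg gyr T H
    by (rule generated_from_imp_invariant_sub)
      (use assms(4,5) in \<open>simp_all add: admissible_subgyrogroup_def\<close>)
  show ?thesis
  \<comment> \<open>The fixed point of comparison is the coset of \<open>zero\<close>; every other
    point is a coset \<open>proj g\<close>, reached by translation.\<close>
  proof (rule pi_character_ordIso_character)
    show "proj zero \<in> topspace quotient"
      by (simp add: topspace_coset_space zero_closed)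
  next
    fix x B assume "x \<in> topspace quotient" and B: "local_pi_base quotient (proj zero) B"
    then obtain g where "g \<in> G" "x = proj g"
      by (auto simp: topspace_coset_space)
    with local_base_of_local_pi_base[OF nbhd_base_zero _ gyr_invariant assms(6) B]
    show "\<exists>f. local_base quotient x (f ` B)"
      using assms(3) unfolding symmetric_set_def by blast
  qed
qed

end
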